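(* Let $H$ be a sparse semigroup of genus $g$, with gaps $\ell_1<\dots<\ell_g$, and let $\kappa:=2g-\ell_g$. Let $D$ be the number of indices $i\in\{1,\dots,g-1\}$ with $\ell_{i+1}-\ell_i=2$ and $S$ the number of indices $i\in\{1,\dots,g-1\}$ with $\ell_{i+1}-\ell_i=1$. Then: (1) $D+S=g-1$; (2) $D=g-\kappa$; (3) $S=\kappa-1$.
   Context: $\mathbb{N}$ is the set of natural numbers including $0$. A numerical semigroup $H\subseteq\mathbb{N}$ of genus $g\ge 1$ is a subset containing $0$, closed under addition, whose complement $\mathbb{N}\setminus H=\{1=\ell_1<\ell_2<\dots<\ell_g\}$ has exactly $g$ elements. Elements of the complement are called gaps and $\ell_g$ is the Frobenius number. $H$ is sparse if $\ell_i-\ell_{i-1}\le 2$ for all $i=2,\dots,g$. *)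

theory Defs
  imports Main
begin

definition numerical_semigroup :: "nat set \<Rightarrow> bool" where
  "numerical_semigroup H \<longleftrightarrow>
     0 \<in> H \<and> (\<forall>a\<in>H. \<forall>b\<in>H. a + b \<in> H) \<and> finite (UNIV - H)"

definition genus :: "nat set \<Rightarrow> nat" where
  "genus H = card (UNIV - H)"

text \<open>The gaps in increasing order, indexed from 1: \<open>gap H i\<close> is meaningful for
  \<open>1 \<le> i \<le> genus H\<close> only, and \<open>gap H (genus H)\<close> is the Frobenius number.\<close>

definition gap :: "nat set \<Rightarrow> nat \<Rightarrow> nat" where
  "gap H i = sorted_list_of_set (UNIV - H) ! (i - 1)"

definition sparse :: "nat set \<Rightarrow> bool" where
  "sparse H \<longleftrightarrow> (\<forall>i\<in>{2..genus H}. int (gap H i) - int (gap H (i - 1)) \<le> 2)"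

end

theory Submission
  imports Defs
begin

text \<open>Gaps increase strictly (\<open>gap_strict_mono\<close>), so in a sparse semigroup each
  of the g - 1 differences of consecutive gaps is 1 or 2. Counting the differences gives D + S = g -
  1. Adding them up telescopes to the last gap minus the first, which is 1 (\<open>gap_one\<close>),
  so 2D + S = \<open>gap H g\<close> - 1. These two linear equations
  (\<open>sum_of_ones_and_twos\<close>) determine D and S.\<close>

text \<open>Since 1 generates all natural numbers under addition, its presence would leave no
  gaps.\<close>

lemma one_notin_numerical_semigroup:
  assumes "numerical_semigroup H" and "genus H \<ge> 1"
  shows "1 \<notin> H"
proof
  assume "1 \<in> H"
  have "n \<in> H" for n
  proof (induction n)
    case 0
    show ?case using assms(1) by (simp add: numerical_semigroup_def)
  next
    case (Suc n)
    then have "n + 1 \<in> H"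
      using assms(1) \<open>1 \<in> H\<close> unfolding numerical_semigroup_def by blast
    then show ?case by simp
  qed
  then have "genus H = card ({} :: nat set)"
    unfolding genus_def by (intro arg_cong[of _ _ card]) blast
  then show False using assms(2) by simp
qed

text \<open>The bound 1 \<le> i keeps the truncated index i - 1 strictly below j - 1.\<close>

lemma gap_strict_mono:
  assumes "1 \<le> i" and "i < j" and "j \<le> genus H"
  shows "gap H i < gap H j"
  using assms sorted_wrt_nth_less[OF strict_sorted_list_of_set[of "UNIV - H"], of "i - 1" "j - 1"]
  by (simp add: gap_def genus_def)

lemma gap_one:
  assumes "numerical_semigroup H" and "genus H \<ge> 1"
  shows "gap H 1 = 1"
proof -
  let ?G = "UNIV - H"
  have fin: "finite ?G" and "0 \<in> H"
    using assms(1) by (auto simp: numerical_semigroup_def)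
  have "1 \<in> ?G" using one_notin_numerical_semigroup[OF assms] by blast
  then have "?G \<noteq> {}" by blast
  then have "gap H 1 = Min ?G"
    using fin by (simp add: gap_def sorted_list_of_set_nonempty)
  also have "\<dots> = 1"
  proof (rule Min_eqI[OF fin _ \<open>1 \<in> ?G\<close>])
    fix y assume "y \<in> ?G"
    with \<open>0 \<in> H\<close> show "1 \<le> y" by (cases y) auto
  qed
  finally show ?thesis .
qed

text \<open>The sets where f is 2 and where f is 1 partition A; cardinality and sum are both
  additive over this partition.\<close>

lemma sum_of_ones_and_twos:
  fixes f :: "'a \<Rightarrow> int"
  assumes "finite A" and "\<And>i. i \<in> A \<Longrightarrow> f i = 1 \<or> f i = 2"
  shows "int (card {i \<in> A. f i = 2}) + int (card {i \<in> A. f i = 1}) = int (card A)"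
    and "2 * int (card {i \<in> A. f i = 2}) + int (card {i \<in> A. f i = 1}) = sum f A"
proof -
  let ?T = "{i \<in> A. f i = 2}" and ?O = "{i \<in> A. f i = 1}"
  have A: "A = ?T \<union> ?O" and disj: "?T \<inter> ?O = {}"
    using assms(2) by auto
  have fin: "finite ?T" "finite ?O" using assms(1) by auto
  have "card A = card ?T + card ?O"
    using card_Un_disjoint[OF fin disj] A by simp
  then show "int (card ?T) + int (card ?O) = int (card A)" by simp
  have "sum f A = sum f ?T + sum f ?O"
    using sum.union_disjoint[OF fin disj, of f] A by simp
  then show "2 * int (card ?T) + int (card ?O) = sum f A" by simp
qed

theorem theorem2p1:
  fixes H :: "nat set" and g D S :: nat and \<kappa> :: int
  assumes "numerical_semigroup H"
    and "genus H = g"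
    and "g \<ge> 1"
    and "sparse H"
    and "\<kappa> = 2 * int g - int (gap H g)"
    and "D = card {i \<in> {1..g - 1}. int (gap H (i + 1)) - int (gap H i) = 2}"
    and "S = card {i \<in> {1..g - 1}. int (gap H (i + 1)) - int (gap H i) = 1}"
  shows "int D + int S = int g - 1 \<and> int D = int g - \<kappa> \<and> int S = \<kappa> - 1"
proof -
  let ?d = "\<lambda>i. int (gap H (i + 1)) - int (gap H i)"
  have steps: "?d i = 1 \<or> ?d i = 2" if "i \<in> {1..g - 1}" for i
  proof -
    have "gap H i < gap H (i + 1)"
      using that assms(2) by (intro gap_strict_mono) auto
    \<comment> \<open>\<open>sparse\<close> indexes a difference by its upper gap, hence the shift
      to i + 1.\<close>
    moreover have "i + 1 \<in> {2..genus H}" using that assms(2) by auto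
    then have "?d i \<le> 2"
      using assms(4) unfolding sparse_def by fastforce
    ultimately show ?thesis by linarith
  qed
  have "sum ?d {1..g - 1} = int (gap H g) - int (gap H 1)"
    \<comment> \<open>Telescoping; g \<ge> 1 turns Suc (g - 1) into g. For g = 1 both sides are
      0.\<close>
    using sum_Suc_diff[of 1 "g - 1" "\<lambda>i. int (gap H i)"] assms(3) by simp
  also have "\<dots> = int (gap H g) - 1"
    using gap_one assms(1-3) by simp
  finally have "2 * int D + int S = int (gap H g) - 1"
    using sum_of_ones_and_twos(2)[of "{1..g - 1}" ?d] steps assms(6,7) by simp
  moreover have "int D + int S = int g - 1"
    using sum_of_ones_and_twos(1)[of "{1..g - 1}" ?d] steps assms(3,6,7) by simp
  \<comment> \<open>Subtracting the equations gives D = \<open>gap H g\<close> - g, which is g -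
    \<kappa>; then S = g - 1 - D.\<close>
  ultimately show ?thesis using assms(5) by linarith
qed

end
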